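(* Let $(A,\mu,\Delta,\alpha)$ be a Hom-bialgebra over $\mathbf{k}$ and let $R\in\mathrm{Hom}(A^{\otimes 2},\mathbf{k})$ be a bilinear form on $A$. Define linear maps $\pi_1,\pi_1',\pi_2,\pi_2'\colon A\to A^*$ by $$\pi_1(x)=R(-\otimes\alpha(x)),\quad \pi_1'(x)=R(\alpha(-)\otimes x),\quad \pi_2(x)=R(\alpha(x)\otimes -),\quad \pi_2'(x)=R(x\otimes\alpha(-)).$$ Then the following statements are equivalent: (1) $R(xy\otimes\alpha(z))=\sum R(\alpha(x)\otimes z_1)R(\alpha(y)\otimes z_2)$ for all $x,y,z\in A$; (2) $\pi_2'\circ\mu=\Delta^*\circ(\pi_2\otimes\pi_2)$ as maps $A\otimes A\to A^*$. If $A$ is finite dimensional, then the two statements above are also equivalent to (3) $\mu^*\circ\pi_1=(\pi_1'\otimes\pi_1')\circ\Delta$ as maps $A\to A^*\otimes A^*$.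
   Context: $\mathbf{k}$ is a field of characteristic $0$; tensor products and linear maps are over $\mathbf{k}$; $A^*=\mathrm{Hom}(A,\mathbf{k})$, and $\langle\phi,v\rangle$ denotes $\phi(v)$. Write $\Delta(x)=\sum x_1\otimes x_2$ (Sweedler) and $xy=\mu(x,y)$. A Hom-bialgebra $(A,\mu,\Delta,\alpha)$ consists of a $\mathbf{k}$-module $A$, a bilinear map $\mu\colon A^{\otimes 2}\to A$, a linear map $\Delta\colon A\to A^{\otimes 2}$ and a linear map $\alpha\colon A\to A$ such that $\alpha\circ\mu=\mu\circ\alpha^{\otimes 2}$, $\mu\circ(\alpha\otimes\mu)=\mu\circ(\mu\otimes\alpha)$, $\alpha^{\otimes 2}\circ\Delta=\Delta\circ\alpha$, $(\alpha\otimes\Delta)\circ\Delta=(\Delta\otimes\alpha)\circ\Delta$, and $\Delta(ab)=\sum a_1b_1\otimes a_2b_2$ for all $a,b\in A$. No unit or counit is required. The map $\Delta^*\colon A^*\otimes A^*\to A^*$ is defined by $\langle\Delta^*(\phi,\psi),x\rangle=\langle\phi\otimes\psi,\Delta(x)\rangle$. When $A$ is finite dimensional, $\mu^*\colon A^*\to A^*\otimes A^*\cong(A\otimes A)^*$ is defined by $\langle\mu^*(\phi),x\otimes y\rangle=\langle\phi,\mu(x,y)\rangle$. *)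

theory Defs
  imports Complex_Main "HOL-Library.Function_Algebras"
begin

section \<open>Vector spaces and linear maps\<close>

text \<open>
  A space is a subspace of a vector space living on a type.  The carrier is needed because the
  tensor product and the dual are proper subsets of function types.  Linear maps are only
  constrained on carriers, so equality of maps is always stated pointwise on the carrier.
\<close>

record ('k, 'v) space =
  smul :: "'k \<Rightarrow> 'v \<Rightarrow> 'v"
  carr :: "'v set"

definition is_space :: "('k::field, 'v::ab_group_add) space \<Rightarrow> bool" where
  "is_space V \<longleftrightarrow> vector_space (smul V) \<and> module.subspace (smul V) (carr V)"

definition full :: "('k::field \<Rightarrow> 'v::ab_group_add \<Rightarrow> 'v) \<Rightarrow> ('k, 'v) space" where
  "full s = \<lparr>smul = s, carr = UNIV\<rparr>"

definition ground :: "('k::field, 'k) space" where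
  "ground = full (*)"

definition lin :: "('k::field, 'v::ab_group_add) space \<Rightarrow> ('k, 'w::ab_group_add) space
    \<Rightarrow> ('v \<Rightarrow> 'w) \<Rightarrow> bool" where
  "lin V W f \<longleftrightarrow> f ` carr V \<subseteq> carr W
     \<and> (\<forall>x\<in>carr V. \<forall>y\<in>carr V. f (x + y) = f x + f y)
     \<and> (\<forall>c. \<forall>x\<in>carr V. f (smul V c x) = smul W c (f x))"

definition bilin :: "('k::field, 'u::ab_group_add) space \<Rightarrow> ('k, 'v::ab_group_add) space
    \<Rightarrow> ('k, 'w::ab_group_add) space \<Rightarrow> ('u \<Rightarrow> 'v \<Rightarrow> 'w) \<Rightarrow> bool" where
  "bilin U V W \<beta> \<longleftrightarrow> (\<forall>u\<in>carr U. lin V W (\<beta> u)) \<and> (\<forall>v\<in>carr V. lin U W (\<lambda>u. \<beta> u v))"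

definition fscale :: "'k::field \<Rightarrow> ('x \<Rightarrow> 'k) \<Rightarrow> 'x \<Rightarrow> 'k" where
  "fscale c f = (\<lambda>x. c * f x)"

text \<open>Functionals are extended by 0 off the carrier, so that equality of functionals is equality
  of functions.\<close>

definition restr :: "('k::field, 'v::ab_group_add) space \<Rightarrow> ('v \<Rightarrow> 'k) \<Rightarrow> 'v \<Rightarrow> 'k" where
  "restr V f = (\<lambda>v. if v \<in> carr V then f v else 0)"

definition dual :: "('k::field, 'v::ab_group_add) space \<Rightarrow> ('k, 'v \<Rightarrow> 'k) space" where
  "dual V = \<lparr>smul = fscale, carr = {\<phi>. lin V ground \<phi> \<and> (\<forall>v. v \<notin> carr V \<longrightarrow> \<phi> v = 0)}\<rparr>"

lemma lin_full_iff_linear: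
  assumes "vector_space s1" "vector_space s2"
  shows "lin (full s1) (full s2) f \<longleftrightarrow> Vector_Spaces.linear s1 s2 f"
  using assms by (auto simp: lin_def full_def Vector_Spaces.linear_iff)

lemma vector_space_fscale: "vector_space (fscale :: 'k::field \<Rightarrow> ('x \<Rightarrow> 'k) \<Rightarrow> 'x \<Rightarrow> 'k)"
  by unfold_locales (auto simp: fscale_def fun_eq_iff algebra_simps)

lemma module_fscale: "module (fscale :: 'k::field \<Rightarrow> ('x \<Rightarrow> 'k) \<Rightarrow> 'x \<Rightarrow> 'k)"
  using vector_space_fscale by (simp add: module_iff_vector_space)

lemma vector_space_mult: "vector_space ((*) :: 'k::field \<Rightarrow> 'k \<Rightarrow> 'k)"
  by unfold_locales (auto simp: algebra_simps)

lemma is_space_full: "vector_space s \<Longrightarrow> is_space (full s)"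
  by (simp add: is_space_def full_def module.subspace_UNIV module_iff_vector_space)

lemma is_space_ground: "is_space ground"
  by (simp add: ground_def is_space_full vector_space_mult)

lemma is_spaceD:
  assumes "is_space V"
  shows "0 \<in> carr V" "\<And>x y. x \<in> carr V \<Longrightarrow> y \<in> carr V \<Longrightarrow> x + y \<in> carr V"
    "\<And>c x. x \<in> carr V \<Longrightarrow> smul V c x \<in> carr V" "vector_space (smul V)"
  using assms unfolding is_space_def
  by (auto simp: module.subspace_def module_iff_vector_space)

lemma is_space_dual:
  assumes "is_space V"
  shows "is_space (dual V)"
  using is_spaceD[OF assms]
  by (auto simp: is_space_def dual_def vector_space_fscale module.subspace_def[OF module_fscale]
      lin_def ground_def full_def fscale_def algebra_simps)

section \<open>The tensor product\<close>

text \<open>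
  The pure tensor \<open>v \<otimes> w\<close> is realised as evaluation of bilinear forms at \<open>(v, w)\<close>, and the tensor
  product as the linear span of the pure tensors inside the functionals on bilinear forms.  The
  universal property is established below (\<open>tensor_universal\<close>), and no later definition depends on
  the choice of realisation.
\<close>

type_synonym ('k, 'v, 'w) tens = "('v \<Rightarrow> 'w \<Rightarrow> 'k) \<Rightarrow> 'k"

definition pure :: "('k::field, 'v::ab_group_add) space \<Rightarrow> ('k, 'w::ab_group_add) space
    \<Rightarrow> 'v \<Rightarrow> 'w \<Rightarrow> ('k, 'v, 'w) tens" where
  "pure V W v w = (\<lambda>\<beta>. if bilin V W ground \<beta> then \<beta> v w else 0)"

definition tensor :: "('k::field, 'v::ab_group_add) space \<Rightarrow> ('k, 'w::ab_group_add) space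
    \<Rightarrow> ('k, ('k, 'v, 'w) tens) space" (infixr \<open>\<Otimes>\<close> 75) where
  "V \<Otimes> W = \<lparr>smul = fscale,
     carr = module.span fscale {pure V W v w | v w. v \<in> carr V \<and> w \<in> carr W}\<rparr>"

text \<open>\<open>tlift V W X \<beta>\<close> is the linear map \<open>V \<Otimes> W \<rightarrow> X\<close> induced by the bilinear map \<open>\<beta>\<close>, unique on the
  carrier.  For \<open>t = \<Sum> v\<^sub>i \<otimes> w\<^sub>i\<close> the value \<open>tlift V W X \<beta> t\<close> is \<open>\<Sum> \<beta> v\<^sub>i w\<^sub>i\<close>, so this is also how
  Sweedler sums are written.\<close>

definition tlift :: "('k::field, 'v::ab_group_add) space \<Rightarrow> ('k, 'w::ab_group_add) space
    \<Rightarrow> ('k, 'x::ab_group_add) space \<Rightarrow> ('v \<Rightarrow> 'w \<Rightarrow> 'x) \<Rightarrow> ('k, 'v, 'w) tens \<Rightarrow> 'x" where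
  "tlift V W X \<beta> = (SOME f. lin (V \<Otimes> W) X f
     \<and> (\<forall>v\<in>carr V. \<forall>w\<in>carr W. f (pure V W v w) = \<beta> v w))"

lemma is_space_tensor: "is_space (V \<Otimes> W)"
  by (simp add: is_space_def tensor_def vector_space_fscale module.subspace_span[OF module_fscale])

lemma pure_in_tensor: "v \<in> carr V \<Longrightarrow> w \<in> carr W \<Longrightarrow> pure V W v w \<in> carr (V \<Otimes> W)"
  unfolding tensor_def by (auto intro!: module.span_base[OF module_fscale])

lemma bilin_pure: "bilin V W (V \<Otimes> W) (pure V W)"
  unfolding bilin_def lin_def
proof (intro conjI ballI allI)
  fix v assume "v \<in> carr V"
  then show "pure V W v ` carr W \<subseteq> carr (V \<Otimes> W)" by (auto intro: pure_in_tensor)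
next
  fix w assume "w \<in> carr W"
  then show "(\<lambda>u. pure V W u w) ` carr V \<subseteq> carr (V \<Otimes> W)" by (auto intro: pure_in_tensor)
qed (auto simp: pure_def fun_eq_iff bilin_def lin_def tensor_def fscale_def ground_def full_def)

lemma tensor_induct [consumes 1, case_names zero step]:
  fixes V :: "('k::field, 'v::ab_group_add) space" and W :: "('k, 'w::ab_group_add) space"
  assumes "t \<in> carr (V \<Otimes> W)"
    and "P 0"
    and "\<And>c v w t. v \<in> carr V \<Longrightarrow> w \<in> carr W \<Longrightarrow> t \<in> carr (V \<Otimes> W) \<Longrightarrow> P t
      \<Longrightarrow> P (smul (V \<Otimes> W) c (pure V W v w) + t)"
  shows "P t"
proof -
  interpret m: module "fscale :: 'k \<Rightarrow> ('k, 'v, 'w) tens \<Rightarrow> _"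
    by (rule module_fscale)
  have "t \<in> m.span {pure V W v w | v w. v \<in> carr V \<and> w \<in> carr W}"
    using assms(1) by (simp add: tensor_def)
  then have "t \<in> carr (V \<Otimes> W) \<and> P t"
  proof (induction rule: m.span_induct_alt)
    case base
    show ?case by (intro conjI is_spaceD(1)[OF is_space_tensor] assms(2))
  next
    case (step c x y)
    then obtain v w where x: "x = pure V W v w" and vw: "v \<in> carr V" "w \<in> carr W" by blast
    have eq: "fscale c x + y = smul (V \<Otimes> W) c (pure V W v w) + y"
      by (simp add: x tensor_def)
    have y: "y \<in> carr (V \<Otimes> W)" "P y" using step.IH by simp_all
    show ?case unfolding eq
      by (intro conjI assms(3) vw y is_spaceD(2,3)[OF is_space_tensor] pure_in_tensor)
  qed
  then show ?thesis ..
qed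

lemma tensor_lin_unique:
  assumes f: "lin (V \<Otimes> W) X f" and g: "lin (V \<Otimes> W) X g" and X: "is_space X"
    and eq: "\<And>v w. v \<in> carr V \<Longrightarrow> w \<in> carr W \<Longrightarrow> f (pure V W v w) = g (pure V W v w)"
    and t: "t \<in> carr (V \<Otimes> W)"
  shows "f t = g t"
  using t
proof (induction rule: tensor_induct)
  case zero
  have "h 0 = 0" if "lin (V \<Otimes> W) X h" for h
    using that is_spaceD(1)[OF is_space_tensor[of V W]] unfolding lin_def
    by (metis add_cancel_right_left)
  then show ?case using f g by metis
next
  case (step c v w t)
  have p: "pure V W v w \<in> carr (V \<Otimes> W)"
    using step pure_in_tensor by blast
  have q: "smul (V \<Otimes> W) c (pure V W v w) \<in> carr (V \<Otimes> W)"
    using p is_spaceD(3)[OF is_space_tensor] by blast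
  have "h (smul (V \<Otimes> W) c (pure V W v w) + t) = smul X c (h (pure V W v w)) + h t"
    if "lin (V \<Otimes> W) X h" for h
    using that p q step(3) unfolding lin_def by auto
  from this[OF f] this[OF g] step.IH eq[OF step.hyps(1,2)] show ?case by metis
qed

lemma functional_separates:
  assumes "vector_space s" and "\<And>\<phi>. Vector_Spaces.linear s (*) \<phi> \<Longrightarrow> \<phi> x = \<phi> y"
  shows "x = y"
proof (rule ccontr)
  assume "x \<noteq> y"
  interpret vector_space s by fact
  interpret p: vector_space_pair s "(*)"
    using assms(1) vector_space_mult by (simp add: vector_space_pair_def)
  have "independent {x - y}" using \<open>x \<noteq> y\<close> by (simp add: dependent_single)
  then obtain g where g: "Vector_Spaces.linear s (*) g" "g (x - y) = 1"
    using p.linear_independent_extend[of "{x - y}" "\<lambda>_. 1"] by auto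
  have "g (x - y) = g x - g y"
    using g(1) by (rule p.linear_diff)
  then show False using assms(2)[OF g(1)] g(2) by simp
qed

theorem tensor_universal:
  assumes X: "is_space X" and \<beta>: "bilin V W X \<beta>"
  shows "\<exists>f. lin (V \<Otimes> W) X f \<and> (\<forall>v\<in>carr V. \<forall>w\<in>carr W. f (pure V W v w) = \<beta> v w)"
proof -
  let ?L = "\<lambda>\<phi>. Vector_Spaces.linear (smul X) (*) \<phi>"
  let ?Q = "\<lambda>t x. x \<in> carr X \<and> (\<forall>\<phi>. ?L \<phi> \<longrightarrow> \<phi> x = t (\<lambda>v w. \<phi> (\<beta> v w)))"
  note Xs = is_spaceD[OF X]
  have form: "bilin V W ground (\<lambda>v w. \<phi> (\<beta> v w))" if "?L \<phi>" for \<phi>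
    using that \<beta> by (auto simp: bilin_def lin_def Vector_Spaces.linear_iff ground_def full_def
        image_subset_iff)
  have uniq: "x = y" if "?Q t x" "?Q t y" for t x y
    using functional_separates[OF Xs(4)] that by metis
  have sum: "?Q (s + t) (x + y)" if "?Q s x" "?Q t y" for s t x y
    using that Xs(2) by (auto simp: Vector_Spaces.linear_iff)
  have scl: "?Q (fscale c t) (smul X c x)" if "?Q t x" for c t x
    using that Xs(3) by (auto simp: Vector_Spaces.linear_iff fscale_def)
  have pur: "?Q (pure V W v w) (\<beta> v w)" if "v \<in> carr V" "w \<in> carr W" for v w
  proof -
    have "\<beta> v w \<in> carr X" using that \<beta> unfolding bilin_def lin_def by blast
    then show ?thesis using form by (auto simp: pure_def)
  qed
  have ex: "\<exists>x. ?Q t x" if "t \<in> carr (V \<Otimes> W)" for t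
    using that
  proof (induction rule: tensor_induct)
    case zero
    have "\<phi> 0 = 0" if "?L \<phi>" for \<phi>
      using that by (metis Vector_Spaces.linear_iff add_cancel_right_left)
    then have "?Q 0 0" using Xs(1) by simp
    then show ?case by blast
  next
    case (step c v w t)
    then obtain y where "?Q t y" by blast
    from sum[OF scl[OF pur[OF step(1,2)]] this] show ?case
      unfolding tensor_def by (simp only: space.simps) blast
  qed
  define f where "f t = (SOME x. ?Q t x)" for t
  have fQ: "?Q t (f t)" if "t \<in> carr (V \<Otimes> W)" for t
    unfolding f_def by (rule someI_ex) (rule ex[OF that])
  have "lin (V \<Otimes> W) X f"
    unfolding lin_def
  proof (intro conjI ballI allI)
    show "f ` carr (V \<Otimes> W) \<subseteq> carr X" using fQ by blast
    fix s t assume s: "s \<in> carr (V \<Otimes> W)" and t: "t \<in> carr (V \<Otimes> W)"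
    show "f (s + t) = f s + f t"
      by (rule uniq[OF fQ sum[OF fQ[OF s] fQ[OF t]]])
        (rule is_spaceD(2)[OF is_space_tensor s t])
  next
    fix c t assume t: "t \<in> carr (V \<Otimes> W)"
    have sm: "smul (V \<Otimes> W) c t = fscale c t" by (simp add: tensor_def)
    show "f (smul (V \<Otimes> W) c t) = smul X c (f t)"
      using uniq[OF fQ[OF is_spaceD(3)[OF is_space_tensor t]] scl[OF fQ[OF t], of c, folded sm]] .
  qed
  moreover have "f (pure V W v w) = \<beta> v w" if "v \<in> carr V" "w \<in> carr W" for v w
    using uniq[OF fQ[OF pure_in_tensor[OF that]] pur[OF that]] .
  ultimately show ?thesis by blast
qed

lemma tlift_spec:
  assumes "is_space X" "bilin V W X \<beta>"
  shows "lin (V \<Otimes> W) X (tlift V W X \<beta>)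
    \<and> (\<forall>v\<in>carr V. \<forall>w\<in>carr W. tlift V W X \<beta> (pure V W v w) = \<beta> v w)"
  unfolding tlift_def by (rule someI_ex[OF tensor_universal[OF assms]])

lemmas lin_tlift = tlift_spec[THEN conjunct1]
lemmas tlift_pure = tlift_spec[THEN conjunct2, rule_format]

definition tmap :: "('k::field, 'v::ab_group_add) space \<Rightarrow> ('k, 'w::ab_group_add) space
    \<Rightarrow> ('k, 'x::ab_group_add) space \<Rightarrow> ('k, 'y::ab_group_add) space
    \<Rightarrow> ('v \<Rightarrow> 'x) \<Rightarrow> ('w \<Rightarrow> 'y) \<Rightarrow> ('k, 'v, 'w) tens \<Rightarrow> ('k, 'x, 'y) tens" where
  "tmap V W X Y f g = tlift V W (X \<Otimes> Y) (\<lambda>v w. pure X Y (f v) (g w))"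

text \<open>The canonical isomorphism \<open>(U \<Otimes> V) \<Otimes> W \<rightarrow> U \<Otimes> V \<Otimes> W\<close>.\<close>

definition tassoc :: "('k::field, 'u::ab_group_add) space \<Rightarrow> ('k, 'v::ab_group_add) space
    \<Rightarrow> ('k, 'w::ab_group_add) space
    \<Rightarrow> ('k, ('k, 'u, 'v) tens, 'w) tens \<Rightarrow> ('k, 'u, ('k, 'v, 'w) tens) tens" where
  "tassoc U V W = tlift (U \<Otimes> V) W (U \<Otimes> V \<Otimes> W)
     (\<lambda>t w. tlift U V (U \<Otimes> V \<Otimes> W) (\<lambda>u v. pure U (V \<Otimes> W) u (pure V W v w)) t)"

text \<open>The functional \<open>\<phi> \<otimes> \<psi>\<close> on \<open>V \<Otimes> W\<close>, with the tensor square of the ground field identified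
  with the ground field by multiplication, and the canonical map \<open>V\<^sup>* \<Otimes> W\<^sup>* \<rightarrow> (V \<Otimes> W)\<^sup>*\<close>.\<close>

definition ftens :: "('k::field, 'v::ab_group_add) space \<Rightarrow> ('k, 'w::ab_group_add) space
    \<Rightarrow> ('v \<Rightarrow> 'k) \<Rightarrow> ('w \<Rightarrow> 'k) \<Rightarrow> ('k, 'v, 'w) tens \<Rightarrow> 'k" where
  "ftens V W \<phi> \<psi> = restr (V \<Otimes> W) (tlift V W ground (\<lambda>v w. \<phi> v * \<psi> w))"

definition dual_tensor :: "('k::field, 'v::ab_group_add) space \<Rightarrow> ('k, 'w::ab_group_add) space
    \<Rightarrow> ('k, 'v \<Rightarrow> 'k, 'w \<Rightarrow> 'k) tens \<Rightarrow> ('k, 'v, 'w) tens \<Rightarrow> 'k" where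
  "dual_tensor V W = tlift (dual V) (dual W) (dual (V \<Otimes> W)) (ftens V W)"

definition fin_dim :: "('k::field, 'v::ab_group_add) space \<Rightarrow> bool" where
  "fin_dim V \<longleftrightarrow> (\<exists>B. finite B \<and> module.span (smul V) B = carr V)"

lemma dual_memI:
  assumes "lin V ground f" and "is_space V"
  shows "restr V f \<in> carr (dual V)"
  using assms(1) is_spaceD[OF assms(2)] by (auto simp: dual_def restr_def lin_def ground_def full_def)

lemma lin_sum:
  assumes f: "lin V X f" and V: "is_space V" and X: "is_space X" and "finite I"
    and g: "\<And>i. i \<in> I \<Longrightarrow> g i \<in> carr V"
  shows "f (\<Sum>i\<in>I. smul V (c i) (g i)) = (\<Sum>i\<in>I. smul X (c i) (f (g i)))"
    "(\<Sum>i\<in>I. smul V (c i) (g i)) \<in> carr V"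
proof -
  note Vs = is_spaceD[OF V]
  have 0: "f 0 = 0" using f Vs(1) unfolding lin_def by (metis add_cancel_right_left)
  have "f (\<Sum>i\<in>I. smul V (c i) (g i)) = (\<Sum>i\<in>I. smul X (c i) (f (g i)))
    \<and> (\<Sum>i\<in>I. smul V (c i) (g i)) \<in> carr V"
    using \<open>finite I\<close> g
  proof (induction I)
    case (insert i I)
    have a: "smul V (c i) (g i) \<in> carr V" using insert Vs(3) by blast
    show ?case using insert a f Vs(2) unfolding lin_def by auto
  qed (use 0 Vs(1) in auto)
  then show "f (\<Sum>i\<in>I. smul V (c i) (g i)) = (\<Sum>i\<in>I. smul X (c i) (f (g i)))"
    "(\<Sum>i\<in>I. smul V (c i) (g i)) \<in> carr V" by auto
qed

lemma dual_basis:
  assumes V: "is_space V" and fin: "fin_dim V"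
  obtains B d where "finite B" "B \<subseteq> carr V" "\<And>b. d b \<in> carr (dual V)"
    "\<And>v. v \<in> carr V \<Longrightarrow> v = (\<Sum>b\<in>B. smul V (d b v) b)"
    "\<And>\<phi>. \<phi> \<in> carr (dual V) \<Longrightarrow> \<phi> = (\<Sum>b\<in>B. smul (dual V) (\<phi> b) (d b))"
proof -
  note Vs = is_spaceD[OF V]
  interpret vector_space "smul V" by (rule Vs(4))
  from fin obtain B0 where B0: "finite B0" "span B0 = carr V" unfolding fin_dim_def by blast
  obtain B where B: "B \<subseteq> B0" "independent B" "B0 \<subseteq> span B"
    using maximal_independent_subset[of B0] by blast
  have finB: "finite B" using B(1) B0(1) finite_subset by blast
  have spB: "span B = carr V"
    using B(1,3) B0(2) span_mono[OF B(1)] span_minimal[OF B(3)] by auto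
  have subB: "B \<subseteq> carr V" using spB span_superset by blast
  define d where "d b = restr V (\<lambda>v. representation B v b)" for b
  have lin: "lin V ground (\<lambda>v. representation B v b)" for b
    using spB B(2) by (auto simp: lin_def ground_def full_def representation_add representation_scale)
  have d: "d b \<in> carr (dual V)" for b
    unfolding d_def by (rule dual_memI[OF lin V])
  have exp: "v = (\<Sum>b\<in>B. smul V (d b v) b)" if "v \<in> carr V" for v
    using sum_representation_eq[OF B(2), of v B] that finB spB
    by (simp add: d_def restr_def)
  have "\<phi> = (\<Sum>b\<in>B. smul (dual V) (\<phi> b) (d b))" if "\<phi> \<in> carr (dual V)" for \<phi>
  proof
    fix v
    have sumv: "(\<Sum>b\<in>B. smul (dual V) (\<phi> b) (d b)) v = (\<Sum>b\<in>B. \<phi> b * d b v)"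
      using finB by (induction B) (auto simp: dual_def fscale_def)
    show "\<phi> v = (\<Sum>b\<in>B. smul (dual V) (\<phi> b) (d b)) v"
    proof (cases "v \<in> carr V")
      case True
      have l: "lin V ground \<phi>" using that by (simp add: dual_def)
      have "\<phi> v = \<phi> (\<Sum>b\<in>B. smul V (d b v) b)" using arg_cong[OF exp[OF True], of \<phi>] .
      also have "\<dots> = (\<Sum>b\<in>B. smul ground (d b v) (\<phi> b))"
        using lin_sum(1)[OF l V is_space_ground finB, of "\<lambda>b. b" "\<lambda>b. d b v"] subB by blast
      finally show ?thesis by (simp add: sumv ground_def full_def mult.commute)
    next
      case False
      then show ?thesis using that by (simp add: sumv) (simp add: dual_def d_def restr_def)
    qed
  qed
  with that[OF finB subB d exp] show thesis by blast
qed

lemma bilin_mult: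
  assumes "lin V ground \<phi>" "lin W ground \<psi>"
  shows "bilin V W ground (\<lambda>v w. \<phi> v * \<psi> w)"
  using assms by (simp add: bilin_def lin_def ground_def full_def distrib_left distrib_right
      mult.left_commute mult.assoc)

lemma dualD: "\<phi> \<in> carr (dual V) \<Longrightarrow> lin V ground \<phi>"
  and smul_dual: "smul (dual V) c \<phi> = fscale c \<phi>"
  by (simp_all add: dual_def)

lemma ftens_pure:
  assumes "\<phi> \<in> carr (dual V)" "\<psi> \<in> carr (dual W)" "v \<in> carr V" "w \<in> carr W"
  shows "ftens V W \<phi> \<psi> (pure V W v w) = \<phi> v * \<psi> w"
  using tlift_pure[OF is_space_ground bilin_mult[OF dualD dualD] assms(3,4), OF assms(1,2)]
    pure_in_tensor[OF assms(3,4)]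
  by (simp add: ftens_def restr_def)

lemma ftens_in_dual:
  assumes "\<phi> \<in> carr (dual V)" "\<psi> \<in> carr (dual W)"
  shows "ftens V W \<phi> \<psi> \<in> carr (dual (V \<Otimes> W))"
  unfolding ftens_def
  by (rule dual_memI[OF lin_tlift[OF is_space_ground bilin_mult[OF dualD dualD]] is_space_tensor])
    (rule assms)+

lemma dual_tensor_eqI:
  assumes f: "f \<in> carr (dual (V \<Otimes> W))" and g: "g \<in> carr (dual (V \<Otimes> W))"
    and eq: "\<And>v w. v \<in> carr V \<Longrightarrow> w \<in> carr W \<Longrightarrow> f (pure V W v w) = g (pure V W v w)"
  shows "f = g"
proof
  fix t
  show "f t = g t"
  proof (cases "t \<in> carr (V \<Otimes> W)")
    case True
    from dualD[OF f] dualD[OF g] is_space_ground eq True show ?thesis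
      by (rule tensor_lin_unique)
  qed (use f g in \<open>simp add: dual_def\<close>)
qed

lemma bilin_ftens:
  assumes V: "is_space V" and W: "is_space W"
  shows "bilin (dual V) (dual W) (dual (V \<Otimes> W)) (ftens V W)"
proof -
  let ?D = "dual (V \<Otimes> W)"
  note D = is_spaceD[OF is_space_dual[OF is_space_tensor[of V W]]]
  note dV = is_spaceD[OF is_space_dual[OF V]] and dW = is_spaceD[OF is_space_dual[OF W]]
  note mem = ftens_in_dual[of _ V _ W] and pur = ftens_pure[of _ V _ W]
  have "lin (dual W) ?D (ftens V W \<phi>)" if \<phi>: "\<phi> \<in> carr (dual V)" for \<phi>
    unfolding lin_def
  proof (intro conjI ballI allI)
    show "ftens V W \<phi> ` carr (dual W) \<subseteq> carr ?D" using mem[OF \<phi>] by blast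
  next
    fix \<psi> \<psi>' assume a: "\<psi> \<in> carr (dual W)" "\<psi>' \<in> carr (dual W)"
    note s = dW(2)[OF a]
    show "ftens V W \<phi> (\<psi> + \<psi>') = ftens V W \<phi> \<psi> + ftens V W \<phi> \<psi>'"
      by (rule dual_tensor_eqI[OF mem[OF \<phi> s] D(2)[OF mem[OF \<phi> a(1)] mem[OF \<phi> a(2)]]])
        (simp only: plus_fun_apply pur \<phi> a s distrib_left)
  next
    fix c \<psi> assume a: "\<psi> \<in> carr (dual W)"
    note s = dW(3)[OF a, of c]
    show "ftens V W \<phi> (smul (dual W) c \<psi>) = smul ?D c (ftens V W \<phi> \<psi>)"
      by (rule dual_tensor_eqI[OF mem[OF \<phi> s] D(3)[OF mem[OF \<phi> a]]])
        (simp only: pur[OF \<phi> s], simp only: smul_dual fscale_def pur \<phi> a mult.left_commute)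
  qed
  moreover have "lin (dual V) ?D (\<lambda>\<phi>. ftens V W \<phi> \<psi>)" if \<psi>: "\<psi> \<in> carr (dual W)" for \<psi>
    unfolding lin_def
  proof (intro conjI ballI allI)
    show "(\<lambda>\<phi>. ftens V W \<phi> \<psi>) ` carr (dual V) \<subseteq> carr ?D" using mem[OF _ \<psi>] by blast
  next
    fix \<phi> \<phi>' assume a: "\<phi> \<in> carr (dual V)" "\<phi>' \<in> carr (dual V)"
    note s = dV(2)[OF a]
    show "ftens V W (\<phi> + \<phi>') \<psi> = ftens V W \<phi> \<psi> + ftens V W \<phi>' \<psi>"
      by (rule dual_tensor_eqI[OF mem[OF s \<psi>] D(2)[OF mem[OF a(1) \<psi>] mem[OF a(2) \<psi>]]])
        (simp only: plus_fun_apply pur \<psi> a s distrib_right)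
  next
    fix c \<phi> assume a: "\<phi> \<in> carr (dual V)"
    note s = dV(3)[OF a, of c]
    show "ftens V W (smul (dual V) c \<phi>) \<psi> = smul ?D c (ftens V W \<phi> \<psi>)"
      by (rule dual_tensor_eqI[OF mem[OF s \<psi>] D(3)[OF mem[OF a \<psi>]]])
        (simp only: pur[OF s \<psi>], simp only: smul_dual fscale_def pur \<psi> a mult.assoc)
  qed
  ultimately show ?thesis by (simp add: bilin_def)
qed

lemma dual_tensor_pure:
  assumes "is_space V" "is_space W" "\<phi> \<in> carr (dual V)" "\<psi> \<in> carr (dual W)"
  shows "dual_tensor V W (pure (dual V) (dual W) \<phi> \<psi>) = ftens V W \<phi> \<psi>"
  unfolding dual_tensor_def
  using tlift_pure[OF is_space_dual[OF is_space_tensor] bilin_ftens[OF assms(1,2)] assms(3,4)] .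

lemma lin_dual_tensor:
  assumes "is_space V" "is_space W"
  shows "lin (dual V \<Otimes> dual W) (dual (V \<Otimes> W)) (dual_tensor V W)"
  unfolding dual_tensor_def
  by (rule lin_tlift[OF is_space_dual[OF is_space_tensor] bilin_ftens[OF assms]])

theorem dual_tensor_bij:
  assumes V: "is_space V" and W: "is_space W" and "fin_dim V" "fin_dim W"
  shows "bij_betw (dual_tensor V W) (carr (dual V \<Otimes> dual W)) (carr (dual (V \<Otimes> W)))"
proof -
  let ?T = "dual V \<Otimes> dual W" and ?D = "dual (V \<Otimes> W)"
  let ?p = "pure (dual V) (dual W)"
  obtain B d where B: "finite B" "B \<subseteq> carr V" "\<And>b. d b \<in> carr (dual V)"
    "\<And>v. v \<in> carr V \<Longrightarrow> v = (\<Sum>b\<in>B. smul V (d b v) b)"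
    "\<And>\<phi>. \<phi> \<in> carr (dual V) \<Longrightarrow> \<phi> = (\<Sum>b\<in>B. smul (dual V) (\<phi> b) (d b))"
    using dual_basis[OF V \<open>fin_dim V\<close>] by blast
  obtain C e where C: "finite C" "C \<subseteq> carr W" "\<And>c. e c \<in> carr (dual W)"
    "\<And>w. w \<in> carr W \<Longrightarrow> w = (\<Sum>c\<in>C. smul W (e c w) c)"
    "\<And>\<psi>. \<psi> \<in> carr (dual W) \<Longrightarrow> \<psi> = (\<Sum>c\<in>C. smul (dual W) (\<psi> c) (e c))"
    using dual_basis[OF W \<open>fin_dim W\<close>] by blast
  have expand: "\<beta> \<phi> \<psi> = (\<Sum>b\<in>B. \<Sum>c\<in>C. \<phi> b * \<psi> c * \<beta> (d b) (e c))"
    if \<beta>: "bilin (dual V) (dual W) ground \<beta>" and \<phi>: "\<phi> \<in> carr (dual V)" and \<psi>: "\<psi> \<in> carr (dual W)"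
    for \<beta> :: "_ \<Rightarrow> _ \<Rightarrow> 'a" and \<phi> \<psi>
  proof -
    have l1: "lin (dual V) ground (\<lambda>f. \<beta> f \<psi>)" using \<beta> \<psi> by (auto simp: bilin_def)
    have l2: "lin (dual W) ground (\<beta> (d b))" for b using \<beta> B(3) by (auto simp: bilin_def)
    have "\<beta> \<phi> \<psi> = (\<Sum>b\<in>B. smul ground (\<phi> b) (\<beta> (d b) \<psi>))"
      by (rule trans[OF arg_cong[OF B(5)[OF \<phi>], of "\<lambda>f. \<beta> f \<psi>"]
            lin_sum(1)[OF l1 is_space_dual[OF V] is_space_ground B(1) B(3)]])
    moreover have "\<beta> (d b) \<psi> = (\<Sum>c\<in>C. smul ground (\<psi> c) (\<beta> (d b) (e c)))" for b
      by (rule trans[OF arg_cong[OF C(5)[OF \<psi>], of "\<beta> (d b)"]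
            lin_sum(1)[OF l2 is_space_dual[OF W] is_space_ground C(1) C(3)]])
    ultimately show ?thesis
      by (simp add: ground_def full_def sum_distrib_left mult.assoc)
  qed
  have key: "T = (\<Sum>(b, c)\<in>B \<times> C. smul ?T (dual_tensor V W T (pure V W b c)) (?p (d b) (e c)))"
    if "T \<in> carr ?T" for T
    using that
  proof (rule tensor_lin_unique[where f="\<lambda>T. T" and X="?T", rotated 4])
    show "lin ?T ?T (\<lambda>T. T)" by (simp add: lin_def)
    have m: "?p (d b) (e c) \<in> carr ?T" for b c using pure_in_tensor B(3) C(3) by blast
    have fm: "(\<Sum>(b, c)\<in>B \<times> C. smul ?T (g b c) (?p (d b) (e c))) \<in> carr ?T" for g
      using lin_sum(2)[of ?T ?T "\<lambda>T. T" "B \<times> C" "\<lambda>(b,c). ?p (d b) (e c)" "\<lambda>(b,c). g b c"]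
        is_space_tensor[of "dual V" "dual W"] m B(1) C(1)
      by (simp add: lin_def case_prod_beta image_subset_iff)
    have L: "lin ?T ?D (dual_tensor V W)" by (rule lin_dual_tensor[OF V W])
    have sm: "smul ?T = fscale" "smul ?D = fscale" by (simp_all add: tensor_def dual_def)
    show "lin ?T ?T
      (\<lambda>T. \<Sum>(b, c)\<in>B \<times> C. smul ?T (dual_tensor V W T (pure V W b c)) (?p (d b) (e c)))"
      unfolding lin_def
    proof (intro conjI ballI allI)
      show "(\<lambda>T. \<Sum>(b, c)\<in>B \<times> C. smul ?T (dual_tensor V W T (pure V W b c)) (?p (d b) (e c)))
        ` carr ?T \<subseteq> carr ?T" by (rule image_subsetI) (rule fm)
    next
      fix S T assume "S \<in> carr ?T" "T \<in> carr ?T"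
      then have "dual_tensor V W (S + T) = dual_tensor V W S + dual_tensor V W T"
        using L by (simp add: lin_def)
      then show "(\<Sum>(b, c)\<in>B \<times> C. smul ?T (dual_tensor V W (S + T) (pure V W b c)) (?p (d b) (e c)))
        = (\<Sum>(b, c)\<in>B \<times> C. smul ?T (dual_tensor V W S (pure V W b c)) (?p (d b) (e c)))
        + (\<Sum>(b, c)\<in>B \<times> C. smul ?T (dual_tensor V W T (pure V W b c)) (?p (d b) (e c)))"
        by (simp add: case_prod_beta sum.distrib[symmetric] sm
            vector_space.vector_space_assms(2)[OF vector_space_fscale])
    next
      fix k T assume "T \<in> carr ?T"
      then have "dual_tensor V W (fscale k T) = fscale k (dual_tensor V W T)"
        using L by (simp add: lin_def sm)
      then show "(\<Sum>(b, c)\<in>B \<times> C. smul ?T (dual_tensor V W (smul ?T k T) (pure V W b c)) (?p (d b) (e c)))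
        = smul ?T k (\<Sum>(b, c)\<in>B \<times> C. smul ?T (dual_tensor V W T (pure V W b c)) (?p (d b) (e c)))"
        by (simp add: case_prod_beta sm module.scale_sum_right[OF module_fscale]
            vector_space.vector_space_assms(3)[OF vector_space_fscale])
          (simp add: fscale_def)
    qed
    show "is_space ?T" by (rule is_space_tensor)
    fix \<phi> \<psi> assume \<phi>: "\<phi> \<in> carr (dual V)" and \<psi>: "\<psi> \<in> carr (dual W)"
    have "dual_tensor V W (?p \<phi> \<psi>) (pure V W b c) = \<phi> b * \<psi> c" if "b \<in> B" "c \<in> C" for b c
      using dual_tensor_pure[OF V W \<phi> \<psi>] ftens_pure[OF \<phi> \<psi>, of b c] that B(2) C(2) by auto
    then have "(\<Sum>(b, c)\<in>B \<times> C.
        smul ?T (dual_tensor V W (?p \<phi> \<psi>) (pure V W b c)) (?p (d b) (e c)))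
      = (\<Sum>(b, c)\<in>B \<times> C. fscale (\<phi> b * \<psi> c) (?p (d b) (e c)))"
      by (intro sum.cong) (auto simp: sm)
    also have "\<dots> = ?p \<phi> \<psi>"
    proof
      fix \<beta>
      have ap: "(\<Sum>i\<in>I. f i) x = (\<Sum>i\<in>I. f i x)" for f :: "_ \<Rightarrow> _ \<Rightarrow> 'a" and I x
        by (induction I rule: infinite_finite_induct) auto
      show "(\<Sum>(b, c)\<in>B \<times> C. fscale (\<phi> b * \<psi> c) (?p (d b) (e c))) \<beta> = ?p \<phi> \<psi> \<beta>"
        using expand[OF _ \<phi> \<psi>, of \<beta>]
        by (auto simp: ap case_prod_beta fscale_def pure_def sum.cartesian_product)
    qed
    finally show "?p \<phi> \<psi> = (\<Sum>(b, c)\<in>B \<times> C.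
        smul ?T (dual_tensor V W (?p \<phi> \<psi>) (pure V W b c)) (?p (d b) (e c)))" by simp
  qed
  have inj: "inj_on (dual_tensor V W) (carr ?T)"
  proof (rule inj_onI)
    fix S T assume S: "S \<in> carr ?T" and T: "T \<in> carr ?T" and "dual_tensor V W S = dual_tensor V W T"
    then show "S = T" by (subst key[OF S], subst key[OF T]) simp
  qed
  have surj: "f \<in> dual_tensor V W ` carr ?T" if f: "f \<in> carr ?D" for f
  proof -
    have l: "lin (V \<Otimes> W) ground f" using f by (simp add: dual_def)
    define T where "T = (\<Sum>i\<in>B \<times> C. smul ?T (f (pure V W (fst i) (snd i))) (?p (d (fst i)) (e (snd i))))"
    have m: "?p (d b) (e c) \<in> carr ?T" for b c using pure_in_tensor B(3) C(3) by blast
    note ls = lin_sum[OF lin_dual_tensor[OF V W] is_space_tensor is_space_dual[OF is_space_tensor],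
        of "B \<times> C" "\<lambda>i. ?p (d (fst i)) (e (snd i))" "\<lambda>i. f (pure V W (fst i) (snd i))", folded T_def]
    have T: "T \<in> carr ?T" using ls(2) B(1) C(1) m by auto
    have DT: "dual_tensor V W T
      = (\<Sum>i\<in>B \<times> C. smul ?D (f (pure V W (fst i) (snd i))) (ftens V W (d (fst i)) (e (snd i))))"
      using ls(1) B(1) C(1) m by (simp add: dual_tensor_pure[OF V W B(3) C(3)])
    have "dual_tensor V W T = f"
    proof (rule dual_tensor_eqI)
      show "dual_tensor V W T \<in> carr ?D"
        using lin_dual_tensor[OF V W] T by (auto simp: lin_def)
      show "f \<in> carr ?D" by (rule f)
      fix v w assume v: "v \<in> carr V" and w: "w \<in> carr W"
      have ap: "(\<Sum>i\<in>I. g i) x = (\<Sum>i\<in>I. g i x)" for g :: "_ \<Rightarrow> _ \<Rightarrow> 'a" and I x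
        by (induction I rule: infinite_finite_induct) auto
      have ft: "ftens V W (d b) (e c) (pure V W v w) = d b v * e c w" for b c
        by (rule ftens_pure[OF B(3) C(3) v w])
      have 1: "dual_tensor V W T (pure V W v w)
        = (\<Sum>i\<in>B \<times> C. f (pure V W (fst i) (snd i)) * (d (fst i) v * e (snd i) w))"
        by (simp add: DT ap) (simp add: dual_def fscale_def ft)
      have bl: "lin V ground (\<lambda>v. f (pure V W v w))" if "w \<in> carr W" for w
        using bilin_pure[of V W] l that by (simp add: bilin_def lin_def image_subset_iff)
      have br: "lin W ground (\<lambda>w. f (pure V W v w))" if "v \<in> carr V" for v
        using bilin_pure[of V W] l that by (simp add: bilin_def lin_def image_subset_iff)
      have "f (pure V W v w) = (\<Sum>b\<in>B. smul ground (d b v) (f (pure V W b w)))"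
        by (rule trans[OF arg_cong[OF B(4)[OF v], of "\<lambda>v. f (pure V W v w)"]
              lin_sum(1)[OF bl[OF w] V is_space_ground B(1)]]) (use B(2) in blast)
      also have "\<dots> = (\<Sum>b\<in>B. smul ground (d b v) (\<Sum>c\<in>C. smul ground (e c w) (f (pure V W b c))))"
      proof (rule sum.cong[OF refl])
        fix b assume "b \<in> B"
        then have b: "b \<in> carr V" using B(2) by blast
        have "f (pure V W b w) = (\<Sum>c\<in>C. smul ground (e c w) (f (pure V W b c)))"
          by (rule trans[OF arg_cong[OF C(4)[OF w], of "\<lambda>w. f (pure V W b w)"]
                lin_sum(1)[OF br[OF b] W is_space_ground C(1)]]) (use C(2) in blast)
        then show "smul ground (d b v) (f (pure V W b w))
          = smul ground (d b v) (\<Sum>c\<in>C. smul ground (e c w) (f (pure V W b c)))" by simp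
      qed
      finally show "dual_tensor V W T (pure V W v w) = f (pure V W v w)"
        unfolding 1
        by (simp add: ground_def full_def sum_distrib_left sum.cartesian_product case_prod_beta
            mult_ac)
    qed
    then show ?thesis using T by blast
  qed
  have "dual_tensor V W ` carr ?T \<subseteq> carr ?D"
    using lin_dual_tensor[OF V W] by (simp add: lin_def)
  with inj surj show ?thesis by (auto simp: bij_betw_def)
qed

section \<open>Hom-bialgebras\<close>

text \<open>The product is a linear map on \<open>A \<Otimes> A\<close>; \<open>prd A \<mu> x y\<close> is \<open>xy\<close>.\<close>

definition prd :: "('k::field, 'a::ab_group_add) space \<Rightarrow> (('k, 'a, 'a) tens \<Rightarrow> 'a)
    \<Rightarrow> 'a \<Rightarrow> 'a \<Rightarrow> 'a" where
  "prd A \<mu> x y = \<mu> (pure A A x y)"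

text \<open>\<open>\<Sum> s\<^sub>1 t\<^sub>1 \<otimes> s\<^sub>2 t\<^sub>2\<close> for \<open>s, t \<in> A \<Otimes> A\<close>.\<close>

definition tprd :: "('k::field, 'a::ab_group_add) space \<Rightarrow> (('k, 'a, 'a) tens \<Rightarrow> 'a)
    \<Rightarrow> ('k, 'a, 'a) tens \<Rightarrow> ('k, 'a, 'a) tens \<Rightarrow> ('k, 'a, 'a) tens" where
  "tprd A \<mu> s t = tlift A A (A \<Otimes> A)
     (\<lambda>a1 a2. tlift A A (A \<Otimes> A) (\<lambda>b1 b2. pure A A (prd A \<mu> a1 b1) (prd A \<mu> a2 b2)) t) s"

definition hom_bialgebra :: "('k::field, 'a::ab_group_add) space
    \<Rightarrow> (('k, 'a, 'a) tens \<Rightarrow> 'a) \<Rightarrow> ('a \<Rightarrow> ('k, 'a, 'a) tens) \<Rightarrow> ('a \<Rightarrow> 'a) \<Rightarrow> bool" where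
  "hom_bialgebra A \<mu> \<Delta> \<alpha> \<longleftrightarrow>
     is_space A \<and> lin (A \<Otimes> A) A \<mu> \<and> lin A (A \<Otimes> A) \<Delta> \<and> lin A A \<alpha> \<and>
     (\<forall>t\<in>carr (A \<Otimes> A). \<alpha> (\<mu> t) = \<mu> (tmap A A A A \<alpha> \<alpha> t)) \<and>
     (\<forall>t\<in>carr ((A \<Otimes> A) \<Otimes> A).
        \<mu> (tmap A (A \<Otimes> A) A A \<alpha> \<mu> (tassoc A A A t)) = \<mu> (tmap (A \<Otimes> A) A A A \<mu> \<alpha> t)) \<and>
     (\<forall>x\<in>carr A. tmap A A A A \<alpha> \<alpha> (\<Delta> x) = \<Delta> (\<alpha> x)) \<and>
     (\<forall>x\<in>carr A. tmap A A A (A \<Otimes> A) \<alpha> \<Delta> (\<Delta> x)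
        = tassoc A A A (tmap A A (A \<Otimes> A) A \<Delta> \<alpha> (\<Delta> x))) \<and>
     (\<forall>a\<in>carr A. \<forall>b\<in>carr A. \<Delta> (prd A \<mu> a b) = tprd A \<mu> (\<Delta> a) (\<Delta> b))"

text \<open>The dual operations: \<open>\<Delta>\<^sup>*\<close> is induced by \<open>(\<phi>, \<psi>) \<mapsto> (\<phi> \<otimes> \<psi>) \<circ> \<Delta>\<close>, and \<open>\<mu>\<^sup>* \<phi>\<close> is the
  preimage of \<open>\<phi> \<circ> \<mu>\<close> under \<open>A\<^sup>* \<Otimes> A\<^sup>* \<cong> (A \<Otimes> A)\<^sup>*\<close>.  The latter is only meaningful when \<open>A\<close> is
  finite-dimensional; see \<open>dual_tensor_bij\<close> and \<open>mu_star_unique\<close>.\<close>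

definition Delta_star :: "('k::field, 'a::ab_group_add) space \<Rightarrow> ('a \<Rightarrow> ('k, 'a, 'a) tens)
    \<Rightarrow> ('k, 'a \<Rightarrow> 'k, 'a \<Rightarrow> 'k) tens \<Rightarrow> 'a \<Rightarrow> 'k" where
  "Delta_star A \<Delta> = tlift (dual A) (dual A) (dual A)
     (\<lambda>\<phi> \<psi>. restr A (\<lambda>x. ftens A A \<phi> \<psi> (\<Delta> x)))"

definition mu_star :: "('k::field, 'a::ab_group_add) space \<Rightarrow> (('k, 'a, 'a) tens \<Rightarrow> 'a)
    \<Rightarrow> ('a \<Rightarrow> 'k) \<Rightarrow> ('k, 'a \<Rightarrow> 'k, 'a \<Rightarrow> 'k) tens" where
  "mu_star A \<mu> \<phi> = (THE T. T \<in> carr (dual A \<Otimes> dual A) \<and>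
     (\<forall>x\<in>carr A. \<forall>y\<in>carr A. dual_tensor A A T (pure A A x y) = \<phi> (prd A \<mu> x y)))"


lemma mu_star_unique:
  assumes A: "is_space A" "fin_dim A" and \<mu>: "lin (A \<Otimes> A) A \<mu>" and \<phi>: "\<phi> \<in> carr (dual A)"
  shows "\<exists>!T. T \<in> carr (dual A \<Otimes> dual A) \<and>
     (\<forall>x\<in>carr A. \<forall>y\<in>carr A. dual_tensor A A T (pure A A x y) = \<phi> (prd A \<mu> x y))"
proof -
  let ?T = "dual A \<Otimes> dual A"
  let ?f = "restr (A \<Otimes> A) (\<lambda>t. \<phi> (\<mu> t))"
  have "lin (A \<Otimes> A) ground (\<lambda>t. \<phi> (\<mu> t))"
    using \<mu> \<phi> by (auto simp: lin_def dual_def ground_def full_def image_subset_iff)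
  then have f: "?f \<in> carr (dual (A \<Otimes> A))" by (rule dual_memI[OF _ is_space_tensor])
  have p: "?f (pure A A x y) = \<phi> (prd A \<mu> x y)" if "x \<in> carr A" "y \<in> carr A" for x y
    using pure_in_tensor[OF that] by (simp add: restr_def prd_def)
  note bij = dual_tensor_bij[OF A(1) A(1) A(2) A(2)]
  have "(\<forall>x\<in>carr A. \<forall>y\<in>carr A. dual_tensor A A T (pure A A x y) = \<phi> (prd A \<mu> x y))
    \<longleftrightarrow> dual_tensor A A T = ?f" if "T \<in> carr ?T" for T
  proof
    assume eq: "\<forall>x\<in>carr A. \<forall>y\<in>carr A. dual_tensor A A T (pure A A x y) = \<phi> (prd A \<mu> x y)"
    show "dual_tensor A A T = ?f"
    proof (rule dual_tensor_eqI[OF _ f])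
      show "dual_tensor A A T \<in> carr (dual (A \<Otimes> A))" by (rule bij_betw_apply[OF bij that])
    qed (simp add: p eq)
  qed (simp add: p)
  note iff = this
  obtain T where T: "T \<in> carr ?T" "dual_tensor A A T = ?f"
    using f[folded bij_betw_imp_surj_on[OF bij]] by (elim imageE) simp
  show ?thesis
  proof (rule ex1I[of _ T])
    show "T \<in> carr ?T \<and> (\<forall>x\<in>carr A. \<forall>y\<in>carr A.
        dual_tensor A A T (pure A A x y) = \<phi> (prd A \<mu> x y))"
      using T(1) iffD2[OF iff[OF T(1)] T(2)] by (rule conjI)
  next
    fix S assume S: "S \<in> carr ?T \<and> (\<forall>x\<in>carr A. \<forall>y\<in>carr A.
        dual_tensor A A S (pure A A x y) = \<phi> (prd A \<mu> x y))"
    have "dual_tensor A A S = ?f"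
      by (rule iffD1[OF iff[OF conjunct1[OF S]] conjunct2[OF S]])
    then have "dual_tensor A A S = dual_tensor A A T" using T(2) by (rule trans[OF _ sym])
    then show "S = T"
      by (rule inj_onD[OF bij_betw_imp_inj_on[OF bij] _ conjunct1[OF S] T(1)])
  qed
qed

definition pi1 :: "('k::field, 'a::ab_group_add) space \<Rightarrow> ('a \<Rightarrow> 'a) \<Rightarrow> (('k, 'a, 'a) tens \<Rightarrow> 'k)
    \<Rightarrow> 'a \<Rightarrow> 'a \<Rightarrow> 'k" where
  "pi1 A \<alpha> R x = restr A (\<lambda>y. R (pure A A y (\<alpha> x)))"

definition pi1' :: "('k::field, 'a::ab_group_add) space \<Rightarrow> ('a \<Rightarrow> 'a) \<Rightarrow> (('k, 'a, 'a) tens \<Rightarrow> 'k)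
    \<Rightarrow> 'a \<Rightarrow> 'a \<Rightarrow> 'k" where
  "pi1' A \<alpha> R x = restr A (\<lambda>y. R (pure A A (\<alpha> y) x))"

definition pi2 :: "('k::field, 'a::ab_group_add) space \<Rightarrow> ('a \<Rightarrow> 'a) \<Rightarrow> (('k, 'a, 'a) tens \<Rightarrow> 'k)
    \<Rightarrow> 'a \<Rightarrow> 'a \<Rightarrow> 'k" where
  "pi2 A \<alpha> R x = restr A (\<lambda>y. R (pure A A (\<alpha> x) y))"

definition pi2' :: "('k::field, 'a::ab_group_add) space \<Rightarrow> ('a \<Rightarrow> 'a) \<Rightarrow> (('k, 'a, 'a) tens \<Rightarrow> 'k)
    \<Rightarrow> 'a \<Rightarrow> 'a \<Rightarrow> 'k" where
  "pi2' A \<alpha> R x = restr A (\<lambda>y. R (pure A A x (\<alpha> y)))"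

end

theory Submission
  imports Defs
begin

text \<open>
  Both sides of (1) are linear in each of \<open>x\<close>, \<open>y\<close>, \<open>z\<close>, so (1) says that two trilinear forms agree.
  Freeing the argument \<open>z\<close> turns it into an equation between functionals of \<open>z\<close> that are bilinear
  in \<open>(x, y)\<close>: the left-hand side becomes \<open>\<pi>\<^sub>2' (xy)\<close> and the right-hand side
  \<open>\<Delta>\<^sup>* (\<pi>\<^sub>2 x \<otimes> \<pi>\<^sub>2 y)\<close>.  A linear map on \<open>A \<Otimes> A\<close> is determined by its values on pure tensors
  (\<open>tensor_lin_unique\<close>), so this is (2).

  Freeing \<open>x\<close> and \<open>y\<close> instead gives, for each \<open>z\<close>, an equation between functionals on \<open>A \<Otimes> A\<close>:
  \<open>\<pi>\<^sub>1 z \<circ> \<mu>\<close> on the left, and on the right the functional that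
  \<open>(\<pi>\<^sub>1' \<otimes> \<pi>\<^sub>1') (\<Delta> z) \<in> A\<^sup>* \<Otimes> A\<^sup>*\<close> represents (\<open>dual_tensor_tmap_curry\<close>).  When \<open>A\<close> has finite
  dimension, \<open>A\<^sup>* \<Otimes> A\<^sup>* \<rightarrow> (A \<Otimes> A)\<^sup>*\<close> is bijective, \<open>\<mu>\<^sup>* (\<pi>\<^sub>1 z)\<close> is by definition the element
  representing \<open>\<pi>\<^sub>1 z \<circ> \<mu>\<close>, and the equation is (3).
\<close>

section \<open>Linear and bilinear maps\<close>

lemma lin_comp: "lin U V f \<Longrightarrow> lin V W g \<Longrightarrow> lin U W (\<lambda>x. g (f x))"
  by (auto simp: lin_def image_subset_iff)

lemma lin_memI: "lin V W f \<Longrightarrow> x \<in> carr V \<Longrightarrow> f x \<in> carr W"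
  by (auto simp: lin_def)

lemma bilin_comp:
  assumes "bilin V W X \<beta>" "lin V' V f" "lin W' W g" "lin X Y h"
  shows "bilin V' W' Y (\<lambda>v w. h (\<beta> (f v) (g w)))"
proof -
  have "lin W' Y (\<lambda>w. h (\<beta> (f v) (g w)))" if "v \<in> carr V'" for v
    using lin_comp[OF lin_comp[OF assms(3)] assms(4)] assms(1) lin_memI[OF assms(2) that]
    by (auto simp: bilin_def)
  moreover have "lin V' Y (\<lambda>v. h (\<beta> (f v) (g w)))" if "w \<in> carr W'" for w
  proof -
    have "lin V X (\<lambda>u. \<beta> u (g w))"
      using assms(1) lin_memI[OF assms(3) that] by (auto simp: bilin_def)
    from lin_comp[OF lin_comp[OF assms(2) this] assms(4)] show ?thesis .
  qed
  ultimately show ?thesis by (simp add: bilin_def)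
qed

lemma lin_id: "lin V V (\<lambda>x. x)"
  by (simp add: lin_def)

lemma bilin_swap: "bilin V W X \<beta> \<Longrightarrow> bilin W V X (\<lambda>w v. \<beta> v w)"
  by (auto simp: bilin_def)

section \<open>Functionals\<close>

lemma lin_eval: "v \<in> carr V \<Longrightarrow> lin (dual V) ground (\<lambda>\<phi>. \<phi> v)"
  by (auto simp: lin_def dual_def ground_def full_def fscale_def)

lemma lin_transpose:
  assumes V: "is_space V" and f: "lin V W f"
  shows "lin (dual W) (dual V) (\<lambda>\<phi>. restr V (\<lambda>v. \<phi> (f v)))"
proof -
  have "restr V (\<lambda>v. \<phi> (f v)) \<in> carr (dual V)" if "\<phi> \<in> carr (dual W)" for \<phi>
    by (rule dual_memI[OF lin_comp[OF f dualD[OF that]] V])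
  then show ?thesis
    by (auto simp: lin_def[of "dual W"] smul_dual fscale_def restr_def fun_eq_iff)
qed

text \<open>All four maps \<open>\<pi>\<close> arise by freezing one argument of a bilinear form, so their linearity is
  this one statement.\<close>

lemma lin_curry:
  assumes W: "is_space W" and b: "bilin V W ground \<beta>"
  shows "lin V (dual W) (\<lambda>v. restr W (\<beta> v))"
proof -
  have "restr W (\<beta> v) \<in> carr (dual W)" if "v \<in> carr V" for v
    using b that by (intro dual_memI[OF _ W]) (auto simp: bilin_def)
  moreover have "\<beta> (u + v) w = \<beta> u w + \<beta> v w" "\<beta> (smul V c v) w = c * \<beta> v w"
    if "u \<in> carr V" "v \<in> carr V" "w \<in> carr W" for u v w c
    using b that by (simp_all add: bilin_def lin_def ground_def full_def)
  ultimately show ?thesis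
    by (auto simp: lin_def smul_dual fscale_def restr_def fun_eq_iff)
qed

text \<open>The functional \<open>ftens\<close> is built from functionals extended by 0, while Sweedler sums use the
  unextended ones; on the tensor product this makes no difference.\<close>

lemma ftens_restr:
  assumes V: "is_space V" and W: "is_space W"
    and \<phi>: "lin V ground \<phi>" and \<psi>: "lin W ground \<psi>" and t: "t \<in> carr (V \<Otimes> W)"
  shows "ftens V W (restr V \<phi>) (restr W \<psi>) t = tlift V W ground (\<lambda>v w. \<phi> v * \<psi> w) t"
proof (rule tensor_lin_unique[OF _ _ is_space_ground _ t])
  note d = dual_memI[OF \<phi> V] dual_memI[OF \<psi> W]
  note s = is_space_ground bilin_mult[OF \<phi> \<psi>]
  show "lin (V \<Otimes> W) ground (ftens V W (restr V \<phi>) (restr W \<psi>))"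
    by (rule dualD[OF ftens_in_dual[OF d]])
  show "lin (V \<Otimes> W) ground (tlift V W ground (\<lambda>v w. \<phi> v * \<psi> w))"
    by (rule lin_tlift[OF s])
  fix v w assume vw: "v \<in> carr V" "w \<in> carr W"
  show "ftens V W (restr V \<phi>) (restr W \<psi>) (pure V W v w)
      = tlift V W ground (\<lambda>v w. \<phi> v * \<psi> w) (pure V W v w)"
    using ftens_pure[OF d vw] tlift_pure[OF s vw] vw by (simp add: restr_def)
qed

section \<open>Tensor products of linear maps\<close>

lemma tmap_bilin:
  assumes "lin V X f" "lin W Y g"
  shows "bilin V W (X \<Otimes> Y) (\<lambda>v w. pure X Y (f v) (g w))"
  by (rule bilin_comp[OF bilin_pure assms lin_id])

lemma lin_tmap:
  assumes "lin V X f" "lin W Y g"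
  shows "lin (V \<Otimes> W) (X \<Otimes> Y) (tmap V W X Y f g)"
  unfolding tmap_def by (rule lin_tlift[OF is_space_tensor tmap_bilin[OF assms]])

lemma tmap_pure:
  assumes "lin V X f" "lin W Y g" "v \<in> carr V" "w \<in> carr W"
  shows "tmap V W X Y f g (pure V W v w) = pure X Y (f v) (g w)"
  unfolding tmap_def
  by (rule tlift_pure[OF is_space_tensor tmap_bilin[OF assms(1,2)] assms(3,4)])

text \<open>Both sides are linear in \<open>t\<close>, and for a pure tensor \<open>t\<close> both are a single product, so they
  agree.  With \<open>t = \<Delta> z\<close> this identifies the element on the right-hand side of (3), regarded as a
  functional on \<open>A \<Otimes> A\<close>, with the Sweedler sum in (1).\<close>

lemma dual_tensor_tmap_curry:
  assumes V: "is_space V" and W: "is_space W"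
    and \<beta>: "bilin X V ground \<beta>" and \<gamma>: "bilin Y W ground \<gamma>"
    and t: "t \<in> carr (X \<Otimes> Y)" and v: "v \<in> carr V" and w: "w \<in> carr W"
  shows "dual_tensor V W
      (tmap X Y (dual V) (dual W) (\<lambda>x. restr V (\<beta> x)) (\<lambda>y. restr W (\<gamma> y)) t) (pure V W v w)
    = tlift X Y ground (\<lambda>x y. \<beta> x v * \<gamma> y w) t"
    (is "dual_tensor V W (?m t) (pure V W v w) = tlift X Y ground ?b t")
proof (rule tensor_lin_unique[OF _ _ is_space_ground _ t])
  note c = lin_curry[OF V \<beta>] lin_curry[OF W \<gamma>]
  have b: "bilin X Y ground ?b"
    using \<beta> \<gamma> v w by (intro bilin_mult) (auto simp: bilin_def)
  show "lin (X \<Otimes> Y) ground (\<lambda>t. dual_tensor V W (?m t) (pure V W v w))"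
    by (rule lin_comp[OF lin_comp[OF lin_tmap[OF c] lin_dual_tensor[OF V W]]
          lin_eval[OF pure_in_tensor[OF v w]]])
  show "lin (X \<Otimes> Y) ground (tlift X Y ground ?b)"
    by (rule lin_tlift[OF is_space_ground b])
  fix x y assume xy: "x \<in> carr X" "y \<in> carr Y"
  note d = lin_memI[OF c(1) xy(1)] lin_memI[OF c(2) xy(2)]
  have "dual_tensor V W (?m (pure X Y x y)) (pure V W v w)
      = ftens V W (restr V (\<beta> x)) (restr W (\<gamma> y)) (pure V W v w)"
    by (simp only: tmap_pure[OF c xy] dual_tensor_pure[OF V W d])
  also have "\<dots> = \<beta> x v * \<gamma> y w"
    using ftens_pure[OF d v w] v w by (simp add: restr_def)
  also have "\<dots> = tlift X Y ground ?b (pure X Y x y)"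
    by (rule tlift_pure[OF is_space_ground b xy, symmetric])
  finally show "dual_tensor V W (?m (pure X Y x y)) (pure V W v w)
      = tlift X Y ground ?b (pure X Y x y)" .
qed

section \<open>The dual operations\<close>

text \<open>The map \<open>(\<phi>, \<psi>) \<mapsto> (\<phi> \<otimes> \<psi>) \<circ> \<Delta>\<close> is \<open>ftens\<close> followed by the transpose of \<open>\<Delta>\<close>.\<close>

lemma Delta_star_bilin:
  assumes "is_space A" "lin A (A \<Otimes> A) \<Delta>"
  shows "bilin (dual A) (dual A) (dual A) (\<lambda>\<phi> \<psi>. restr A (\<lambda>x. ftens A A \<phi> \<psi> (\<Delta> x)))"
  by (rule bilin_comp[OF bilin_ftens[OF assms(1,1)] lin_id lin_id lin_transpose[OF assms]])

lemma lin_Delta_star: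
  assumes "is_space A" "lin A (A \<Otimes> A) \<Delta>"
  shows "lin (dual A \<Otimes> dual A) (dual A) (Delta_star A \<Delta>)"
  unfolding Delta_star_def
  by (rule lin_tlift[OF is_space_dual[OF assms(1)] Delta_star_bilin[OF assms]])

lemma Delta_star_pure:
  assumes "is_space A" "lin A (A \<Otimes> A) \<Delta>" "\<phi> \<in> carr (dual A)" "\<psi> \<in> carr (dual A)"
  shows "Delta_star A \<Delta> (pure (dual A) (dual A) \<phi> \<psi>) = restr A (\<lambda>x. ftens A A \<phi> \<psi> (\<Delta> x))"
  unfolding Delta_star_def
  by (rule tlift_pure[OF is_space_dual[OF assms(1)] Delta_star_bilin[OF assms(1,2)] assms(3,4)])

text \<open>Since \<open>\<mu>\<^sup>* \<phi>\<close> is a definite description, an equation such as (3) is checked by pairing the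
  proposed value with pure tensors.\<close>

lemma mu_star_eq_iff:
  assumes A: "is_space A" "fin_dim A" and \<mu>: "lin (A \<Otimes> A) A \<mu>" and \<phi>: "\<phi> \<in> carr (dual A)"
    and T: "T \<in> carr (dual A \<Otimes> dual A)"
  shows "mu_star A \<mu> \<phi> = T
    \<longleftrightarrow> (\<forall>x\<in>carr A. \<forall>y\<in>carr A. dual_tensor A A T (pure A A x y) = \<phi> (prd A \<mu> x y))"
  using theI'[OF mu_star_unique[OF A \<mu> \<phi>]] the1_equality[OF mu_star_unique[OF A \<mu> \<phi>]] T
  unfolding mu_star_def by blast

section \<open>The three conditions\<close>

theorem theorem2p8:
  fixes A :: "('k::field_char_0, 'a::ab_group_add) space"
    and \<mu> :: "('k, 'a, 'a) tens \<Rightarrow> 'a"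
    and \<Delta> :: "'a \<Rightarrow> ('k, 'a, 'a) tens"
    and \<alpha> :: "'a \<Rightarrow> 'a"
    and R :: "('k, 'a, 'a) tens \<Rightarrow> 'k"
  assumes "hom_bialgebra A \<mu> \<Delta> \<alpha>"
    and "lin (A \<Otimes> A) ground R"
  shows
    "((\<forall>x\<in>carr A. \<forall>y\<in>carr A. \<forall>z\<in>carr A.
         R (pure A A (prd A \<mu> x y) (\<alpha> z))
           = tlift A A ground
               (\<lambda>z1 z2. R (pure A A (\<alpha> x) z1) * R (pure A A (\<alpha> y) z2)) (\<Delta> z))
       \<longleftrightarrow>
       (\<forall>t\<in>carr (A \<Otimes> A).
         pi2' A \<alpha> R (\<mu> t)
           = Delta_star A \<Delta> (tmap A A (dual A) (dual A) (pi2 A \<alpha> R) (pi2 A \<alpha> R) t)))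
     \<and>
     (fin_dim A \<longrightarrow>
       ((\<forall>t\<in>carr (A \<Otimes> A).
           pi2' A \<alpha> R (\<mu> t)
             = Delta_star A \<Delta> (tmap A A (dual A) (dual A) (pi2 A \<alpha> R) (pi2 A \<alpha> R) t))
        \<longleftrightarrow>
        (\<forall>x\<in>carr A.
           mu_star A \<mu> (pi1 A \<alpha> R x)
             = tmap A A (dual A) (dual A) (pi1' A \<alpha> R) (pi1' A \<alpha> R) (\<Delta> x))))"
proof -
  have A: "is_space A" and \<mu>: "lin (A \<Otimes> A) A \<mu>" and \<Delta>: "lin A (A \<Otimes> A) \<Delta>" and \<alpha>: "lin A A \<alpha>"
    using assms(1) by (auto simp: hom_bialgebra_def)
  let ?r = "\<lambda>x y. R (pure A A x y)"
  let ?S = "\<lambda>x y z. tlift A A ground (\<lambda>z1 z2. ?r (\<alpha> x) z1 * ?r (\<alpha> y) z2) (\<Delta> z)"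
  have r\<alpha>: "bilin A A ground (\<lambda>x y. ?r (\<alpha> x) y)" "bilin A A ground (\<lambda>x y. ?r x (\<alpha> y))"
    using bilin_comp[OF bilin_pure \<alpha> lin_id assms(2)] bilin_comp[OF bilin_pure lin_id \<alpha> assms(2)]
    by simp_all
  have pi1_eq: "pi1 A \<alpha> R = (\<lambda>x. restr A (\<lambda>y. ?r y (\<alpha> x)))"
    and pi1'_eq: "pi1' A \<alpha> R = (\<lambda>x. restr A (\<lambda>y. ?r (\<alpha> y) x))"
    and pi2_eq: "pi2 A \<alpha> R = (\<lambda>x. restr A (\<lambda>y. ?r (\<alpha> x) y))"
    and pi2'_eq: "pi2' A \<alpha> R = (\<lambda>x. restr A (\<lambda>y. ?r x (\<alpha> y)))"
    by (simp_all add: fun_eq_iff pi1_def pi1'_def pi2_def pi2'_def)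
  have pi1: "lin A (dual A) (pi1 A \<alpha> R)" and pi1': "lin A (dual A) (pi1' A \<alpha> R)"
    and pi2: "lin A (dual A) (pi2 A \<alpha> R)" and pi2': "lin A (dual A) (pi2' A \<alpha> R)"
    unfolding pi1_eq pi1'_eq pi2_eq pi2'_eq
    by (rule lin_curry[OF A] r\<alpha> r\<alpha>[THEN bilin_swap])+
  have prd: "prd A \<mu> x y \<in> carr A" if "x \<in> carr A" "y \<in> carr A" for x y
    unfolding prd_def by (rule lin_memI[OF \<mu> pure_in_tensor[OF that]])
  let ?P1 = "\<forall>x\<in>carr A. \<forall>y\<in>carr A. \<forall>z\<in>carr A. ?r (prd A \<mu> x y) (\<alpha> z) = ?S x y z"
  let ?rhs2 = "\<lambda>t. Delta_star A \<Delta> (tmap A A (dual A) (dual A) (pi2 A \<alpha> R) (pi2 A \<alpha> R) t)"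
  let ?P2 = "\<forall>t\<in>carr (A \<Otimes> A). pi2' A \<alpha> R (\<mu> t) = ?rhs2 t"
  let ?T = "\<lambda>z. tmap A A (dual A) (dual A) (pi1' A \<alpha> R) (pi1' A \<alpha> R) (\<Delta> z)"
  let ?P3 = "\<forall>z\<in>carr A. mu_star A \<mu> (pi1 A \<alpha> R z) = ?T z"
  have rhs2: "?rhs2 (pure A A x y) = restr A (?S x y)" if xy: "x \<in> carr A" "y \<in> carr A" for x y
  proof -
    have l: "lin A ground (?r (\<alpha> x))" "lin A ground (?r (\<alpha> y))"
      using r\<alpha>(1) xy by (auto simp: bilin_def)
    have "?rhs2 (pure A A x y) = restr A (\<lambda>z. ftens A A (pi2 A \<alpha> R x) (pi2 A \<alpha> R y) (\<Delta> z))"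
      by (simp only: tmap_pure[OF pi2 pi2 xy]
          Delta_star_pure[OF A \<Delta> lin_memI[OF pi2 xy(1)] lin_memI[OF pi2 xy(2)]])
    also have "\<dots> = restr A (?S x y)"
      using ftens_restr[OF A A l lin_memI[OF \<Delta>]] by (auto simp: restr_def[of A] pi2_eq fun_eq_iff)
    finally show ?thesis .
  qed
  have "?P1 \<longleftrightarrow> (\<forall>x\<in>carr A. \<forall>y\<in>carr A. pi2' A \<alpha> R (\<mu> (pure A A x y)) = ?rhs2 (pure A A x y))"
    by (auto simp: rhs2 pi2'_eq prd_def restr_def fun_eq_iff)
  also have "\<dots> \<longleftrightarrow> ?P2"
  proof
    assume "?P2"
    then show "\<forall>x\<in>carr A. \<forall>y\<in>carr A. pi2' A \<alpha> R (\<mu> (pure A A x y)) = ?rhs2 (pure A A x y)"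
      using pure_in_tensor[of _ A _ A] by blast
  next
    assume eq: "\<forall>x\<in>carr A. \<forall>y\<in>carr A. pi2' A \<alpha> R (\<mu> (pure A A x y)) = ?rhs2 (pure A A x y)"
    have "pi2' A \<alpha> R (\<mu> t) = ?rhs2 t" if "t \<in> carr (A \<Otimes> A)" for t
      by (rule tensor_lin_unique[OF lin_comp[OF \<mu> pi2']
            lin_comp[OF lin_tmap[OF pi2 pi2] lin_Delta_star[OF A \<Delta>]] is_space_dual[OF A] _ that])
        (use eq in blast)
    then show "?P2" by blast
  qed
  finally have 12: "?P1 \<longleftrightarrow> ?P2" .
  have "?P1 \<longleftrightarrow> ?P3" if fin: "fin_dim A"
  proof -
    have "mu_star A \<mu> (pi1 A \<alpha> R z) = ?T z
        \<longleftrightarrow> (\<forall>x\<in>carr A. \<forall>y\<in>carr A. ?r (prd A \<mu> x y) (\<alpha> z) = ?S x y z)"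
      if z: "z \<in> carr A" for z
    proof -
      have "dual_tensor A A (?T z) (pure A A x y) = ?S x y z"
        if "x \<in> carr A" "y \<in> carr A" for x y
        unfolding pi1'_eq
        by (rule dual_tensor_tmap_curry[OF A A bilin_swap[OF r\<alpha>(1)] bilin_swap[OF r\<alpha>(1)]
              lin_memI[OF \<Delta> z] that])
      moreover have "pi1 A \<alpha> R z (prd A \<mu> x y) = ?r (prd A \<mu> x y) (\<alpha> z)"
        if "x \<in> carr A" "y \<in> carr A" for x y
        using prd[OF that] by (simp add: pi1_eq restr_def)
      ultimately show ?thesis
        using mu_star_eq_iff[OF A fin \<mu> lin_memI[OF pi1 z]
            lin_memI[OF lin_tmap[OF pi1' pi1'] lin_memI[OF \<Delta> z]]] by auto
    qed
    then show ?thesis by blast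
  qed
  with 12 show ?thesis by blast
qed

end
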